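(* Let $A$ be a differential graded algebra over a field with cohomology $H$, let $n\ge3$, let $x_1,\dots,x_n\in H$ be homogeneous classes and let $x\in\langle x_1,\dots,x_n\rangle$. Then, for any contraction $(A,H,i,q,K)$ adapted to $x$, the $n$th multiplication $m_n$ of the $A_\infty$ structure on $H$ induced by the contraction satisfies $$\varepsilon\, m_n(x_1,\dots,x_n)=x,\qquad \varepsilon=(-1)^{1+|x_{n-1}|+|x_{n-3}|+\cdots},$$ where the sum in the exponent runs over the indices $n-1,n-3,\dots$ that are $\ge1$.
   Context: Graded objects are graded over $\mathbb{Z}$ with upper grading, differentials have degree $+1$, everything is over a field, and the Koszul sign rule is used. Contractions: a contraction $(A,H,i,q,K)$ of a DGA $A$ onto its cohomology $H$ (with zero differential) consists of cochain maps $i\colon H\to A$, $q\colon A\to H$ and a degree $-1$ linear map $K\colon A\to A$ with $qi=\mathrm{id}_H$, $\mathrm{id}_A-iq=dK+Kd$, and $K^2=Ki=qK=0$, where $i(y)$ is a cocycle representing $y$ for each $y\in H$. Equivalently, it is a decomposition $A=B\oplus dB\oplus C$ with $B$ a complement of $\operatorname{Ker}d$ and $C\cong H$, where $B=KdA$, $C=\operatorname{Im} i$, $K$ vanishes on $B$ and $C$ and is inverse to $d\colon B\to dB$ on $dB$. Induced $A_\infty$ structure: a contraction induces a minimal $A_\infty$ structure $\{m_k\}_{k\ge2}$ on $H$ as follows. Formally set $K\lambda_1=-i$, and define recursively $\lambda_k\colon H^{\otimes k}\to A$ for $k\ge2$ by $$\lambda_k=m\Bigl(\sum_{s=1}^{k-1}(-1)^{s+1}K\lambda_s\otimes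 K\lambda_{k-s}\Bigr),$$ where $m$ is the multiplication of $A$. Then $m_k=q\circ\lambda_k$ for $k\ge 2$. Massey products: for homogeneous $a\in A$ write $\overline a=(-1)^{|a|+1}a$. For $n\ge3$ and homogeneous $x_1,\dots,x_n\in H$, a defining system is a set $\{a_{ij}\}_{0\le i<j\le n,\ 1\le j-i\le n-1}\subseteq A$ of homogeneous elements such that $a_{i-1,i}$ is a cocycle representing $x_i$ for $i=1,\dots,n$, and $d(a_{ij})=\sum_{i<k<j}\overline{a}_{ik}a_{kj}$ whenever $2\le j-i\le n-1$. The Massey product set $\langle x_1,\dots,x_n\rangle\subseteq H$ is the set of all classes $[\sum_{0<k<n}\overline a_{0k}a_{kn}]$ as $\{a_{ij}\}$ runs over all defining systems; such a class is said to be given by the defining system $\{a_{ij}\}$. Adapted: for $x\in\langle x_1,\dots,x_n\rangle$, a contraction $(A,H,i,q,K)$ is adapted to $x$ if there is a defining system $\{a_{ij}\}$ giving $x$ such that $i(x_j)=a_{j-1,j}$ for every $j$ and $\{a_{ij}\}_{j-i\ge2}\subseteq KdA$. *)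

theory Defs
  imports Complex_Main "HOL-Library.Set_Algebras"
begin

text \<open>
  The algebra is modelled on a whole type, graded by the subspaces \<open>gr p\<close>, whose internal direct
  sum it is. No unit is required; the class \<open>ring_1\<close> would moreover exclude the zero algebra.
\<close>

locale dga = vector_space scale
  for scale :: "'k::field \<Rightarrow> 'a::ring \<Rightarrow> 'a" (infixr \<open>*s\<close> 75) +
  fixes gr :: "int \<Rightarrow> 'a set"
    and d :: "'a \<Rightarrow> 'a"
  assumes scale_mult_left: "(c *s a) * b = c *s (a * b)"
    and scale_mult_right: "a * (c *s b) = c *s (a * b)"
    and subspace_gr: "subspace (gr p)"
    and gr_decomposition:
      "\<exists>!f. (\<forall>p. f p \<in> gr p) \<and> finite {p. f p \<noteq> 0} \<and> a = (\<Sum>p | f p \<noteq> 0. f p)"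
    and mult_gr: "a \<in> gr p \<Longrightarrow> b \<in> gr q \<Longrightarrow> a * b \<in> gr (p + q)"
    and linear_d: "Vector_Spaces.linear scale scale d"
    and d_gr: "a \<in> gr p \<Longrightarrow> d a \<in> gr (p + 1)"
    and d_d: "d (d a) = 0"
    and leibniz: "a \<in> gr p \<Longrightarrow> d (a * b) = d a * b + (-1) powi p *s (a * d b)"
begin

text \<open>
  Cohomology classes are cosets of \<open>range d\<close>, added with the Minkowski sum of
  \<^theory>\<open>HOL-Library.Set_Algebras\<close>. The zero class is \<open>range d\<close>, not \<open>0 = {0}\<close>. Adding \<open>range d\<close> in
  \<open>hscale\<close> matters only for the scalar \<open>0\<close>.
\<close>

definition cocycles :: "'a set" where
  "cocycles = {z. d z = 0}"

definition cls :: "'a \<Rightarrow> 'a set" where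
  "cls z = z +o range d"

definition cohomology :: "'a set set" where
  "cohomology = cls ` cocycles"

definition hgr :: "int \<Rightarrow> 'a set set" where
  "hgr p = cls ` (cocycles \<inter> gr p)"

definition hscale :: "'k \<Rightarrow> 'a set \<Rightarrow> 'a set" where
  "hscale c X = (scale c ` X) + range d"

definition degree :: "'a \<Rightarrow> int" where
  "degree a = (SOME p. a \<in> gr p)"

definition bar :: "'a \<Rightarrow> 'a" where
  "bar a = (-1) powi (degree a + 1) *s a"

definition component :: "'a \<Rightarrow> int \<Rightarrow> 'a" where
  "component a =
    (THE f. (\<forall>p. f p \<in> gr p) \<and> finite {p. f p \<noteq> 0} \<and> a = (\<Sum>p | f p \<noteq> 0. f p))"

text \<open>
  \<open>twist e\<close> is the linear map with value \<open>(-1)^(e * p) a\<close> on \<open>a\<close> of degree \<open>p\<close>: the Koszul sign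
  created when a map of degree \<open>e\<close> moves past \<open>a\<close>. It preserves \<open>range d\<close>, so \<open>htwist e\<close> is the
  map induced on cohomology classes.
\<close>

definition twist :: "int \<Rightarrow> 'a \<Rightarrow> 'a" where
  "twist e a = (\<Sum>p | component a p \<noteq> 0. (-1) powi (e * p) *s component a p)"

lemma twist_homogeneous:
  assumes "a \<in> gr p"
  shows "twist e a = (-1) powi (e * p) *s a"
proof -
  let ?f = "\<lambda>r. if r = p then a else 0"
  have "(\<forall>r. ?f r \<in> gr r) \<and> finite {r. ?f r \<noteq> 0} \<and> a = (\<Sum>r | ?f r \<noteq> 0. ?f r)"
    using assms subspace_0[OF subspace_gr] by auto
  then have "component a = ?f"
    unfolding component_def by (rule the1_equality[OF gr_decomposition])
  then show ?thesis
    unfolding twist_def by (cases "a = 0") simp_all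
qed

definition htwist :: "int \<Rightarrow> 'a set \<Rightarrow> 'a set" where
  "htwist e X = twist e ` X"

definition defining_system :: "nat \<Rightarrow> (nat \<Rightarrow> 'a set) \<Rightarrow> (nat \<Rightarrow> nat \<Rightarrow> 'a) \<Rightarrow> bool" where
  "defining_system n x a \<longleftrightarrow>
    (\<forall>i j. i < j \<and> j \<le> n \<and> j - i \<le> n - 1 \<longrightarrow> (\<exists>p. a i j \<in> gr p)) \<and>
    (\<forall>i\<in>{1..n}. a (i - 1) i \<in> cocycles \<and> cls (a (i - 1) i) = x i) \<and>
    (\<forall>i j. i < j \<and> j \<le> n \<and> 2 \<le> j - i \<and> j - i \<le> n - 1 \<longrightarrow>
      d (a i j) = (\<Sum>k\<in>{i<..<j}. bar (a i k) * a k j))"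

definition given_class :: "nat \<Rightarrow> (nat \<Rightarrow> nat \<Rightarrow> 'a) \<Rightarrow> 'a set" where
  "given_class n a = cls (\<Sum>k\<in>{0<..<n}. bar (a 0 k) * a k n)"

definition massey :: "nat \<Rightarrow> (nat \<Rightarrow> 'a set) \<Rightarrow> 'a set set" where
  "massey n x = {given_class n a |a. defining_system n x a}"

end

text \<open>The maps \<open>i\<close> and \<open>q\<close> are constrained only on, respectively with values in, cohomology.\<close>

locale contraction = dga scale gr d
  for scale :: "'k::field \<Rightarrow> 'a::ring \<Rightarrow> 'a" (infixr \<open>*s\<close> 75)
    and gr :: "int \<Rightarrow> 'a set" and d :: "'a \<Rightarrow> 'a" +
  fixes i :: "'a set \<Rightarrow> 'a" and q :: "'a \<Rightarrow> 'a set" and K :: "'a \<Rightarrow> 'a"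
  assumes i_add: "X \<in> cohomology \<Longrightarrow> Y \<in> cohomology \<Longrightarrow> i (X + Y) = i X + i Y"
    and i_scale: "X \<in> cohomology \<Longrightarrow> i (hscale c X) = c *s i X"
    and i_gr: "X \<in> hgr p \<Longrightarrow> i X \<in> gr p"
    and d_i: "X \<in> cohomology \<Longrightarrow> d (i X) = 0"
    and i_represents: "X \<in> cohomology \<Longrightarrow> cls (i X) = X"
    and q_cohomology: "q a \<in> cohomology"
    and q_add: "q (a + b) = q a + q b"
    and q_scale: "q (c *s a) = hscale c (q a)"
    and q_gr: "a \<in> gr p \<Longrightarrow> q a \<in> hgr p"
    and q_d: "q (d a) = cls 0"
    and linear_K: "Vector_Spaces.linear scale scale K"
    and K_gr: "a \<in> gr p \<Longrightarrow> K a \<in> gr (p - 1)"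
    and q_i: "X \<in> cohomology \<Longrightarrow> q (i X) = X"
    and homotopy: "a - i (q a) = d (K a) + K (d a)"
    and K_K: "K (K a) = 0"
    and K_i: "X \<in> cohomology \<Longrightarrow> K (i X) = 0"
    and q_K: "q (K a) = cls 0"
begin

text \<open>
  Linear maps on the \<open>k\<close>-th tensor power of cohomology are represented as multilinear maps on lists
  of length \<open>k\<close>. The map \<open>K \<lambda>\<^sub>t\<close> has degree \<open>1 - t\<close>, hence the twist of the first \<open>s\<close> arguments
  when \<open>K \<lambda>\<^sub>s \<otimes> K \<lambda>\<^sub>t\<close> is evaluated.
\<close>

function lam :: "'a set list \<Rightarrow> 'a" and Klam :: "'a set list \<Rightarrow> 'a" where
  "lam xs =
    (\<Sum>s\<in>{1..<length xs}. (-1) ^ (s + 1) *s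
      (Klam (map (htwist (1 - int (length xs - s))) (take s xs)) * Klam (drop s xs)))"
| "Klam xs = (if length xs = 1 then - i (hd xs) else K (lam xs))"
  by pat_completeness auto
termination
  by (relation "measure (case_sum (\<lambda>xs. 2 * length xs) (\<lambda>xs. 2 * length xs + 1))") auto

declare lam.simps [simp del] Klam.simps [simp del]

definition mu :: "'a set list \<Rightarrow> 'a set" where
  "mu xs = q (lam xs)"

definition adapted :: "nat \<Rightarrow> (nat \<Rightarrow> 'a set) \<Rightarrow> 'a set \<Rightarrow> bool" where
  "adapted n x y \<longleftrightarrow>
    (\<exists>a. defining_system n x a \<and> given_class n a = y \<and>
      (\<forall>j\<in>{1..n}. i (x j) = a (j - 1) j) \<and>
      (\<forall>r s. r < s \<and> s \<le> n \<and> 2 \<le> s - r \<and> s - r \<le> n - 1 \<longrightarrow> a r s \<in> K ` range d))"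

end

end

theory Submission
  imports Defs
begin

text \<open>
  Write \<open>a r s\<close> for the defining system and \<open>W r s\<close> for the word \<open>x (r+1), \<dots>, x s\<close>. The recursion for
  \<open>\<lambda>\<close> and the equation for \<open>d (a r s)\<close> are both sums over the ways of cutting the word in two, and
  the theorem says that they agree up to sign: \<open>lam (W r s) = \<epsilon> r s \<cdot> (\<Sum>k. bar (a r k) * a k s)\<close>, and,
  on proper subwords, \<open>Klam (W r s) = \<epsilon> r s \<cdot> a r s\<close> (\<open>lam_word_step\<close>, \<open>Klam_word_entry\<close>).

  The second equation follows from the first because the contraction is adapted. On \<open>K ` range d\<close>
  the map \<open>K\<close> inverts \<open>d\<close>, so \<open>K\<close> sends the sum over \<open>k\<close>, which is \<open>d (a r s)\<close>, back to \<open>a r s\<close>. The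
  first equation follows from the second for shorter words, provided that the signs fit. The same
  inversion forces each \<open>a r s\<close> to have the expected degree, so that all signs are functions of the
  degrees \<open>p l\<close> of the classes. They are: the Koszul sign, which is the sign by which \<open>Klam\<close>
  changes when its arguments are twisted (\<open>Klam_twist\<close>); the sign \<open>(-1)^(s+1)\<close> of the recursion; and
  the sign in \<open>bar\<close>. What is required is the cocycle-like identity \<open>sign_exponent_split\<close>, which
  the exponent \<open>1 + (\<Sum>l. (s - l) * p l)\<close> satisfies; modulo 2 this is the exponent \<open>1 + p (s-1) +
  p (s-3) + \<dots>\<close> of the theorem.

  Finally \<open>q\<close> is applied to the equation for the full word. On a cocycle \<open>q\<close> takes the cohomology
  class, and \<open>\<Sum>k. bar (a 0 k) * a k n\<close> is a cocycle by the usual cancellation (\<open>cocycle_massey\<close>).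
\<close>

section \<open>Signs and degrees of words\<close>

lemma minus_one_powi: "(-1 :: 'k::field) powi m = (if even m then 1 else -1)"
  by (simp add: power_int_minus_left)

lemma minus_one_powi_cong: "even (m - l) \<Longrightarrow> (-1 :: 'k::field) powi m = (-1) powi l"
  by (auto simp: minus_one_powi)

lemma minus_one_powi_add: "(-1 :: 'k::field) powi (m + l) = (-1) powi m * (-1) powi l"
  by (simp add: minus_one_powi)

definition word :: "(nat \<Rightarrow> 'b) \<Rightarrow> nat \<Rightarrow> nat \<Rightarrow> 'b list" where
  "word x r s = map x [Suc r..<Suc s]"

lemma length_word [simp]: "length (word x r s) = s - r"
  by (simp add: word_def del: upt_Suc)

lemma map_word: "map f (word x r s) = word (f \<circ> x) r s"
  by (simp add: word_def)

lemma word_cong: "(\<And>l. l \<in> {r<..s} \<Longrightarrow> x l = x' l) \<Longrightarrow> word x r s = word x' r s"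
  by (auto simp: word_def)

lemma take_word: "r \<le> k \<Longrightarrow> k \<le> s \<Longrightarrow> take (k - r) (word x r s) = word x r k"
  by (simp add: word_def take_map del: upt_Suc)

lemma drop_word: "r \<le> k \<Longrightarrow> k \<le> s \<Longrightarrow> drop (k - r) (word x r s) = word x k s"
  by (simp add: word_def drop_map del: upt_Suc)

definition degree_sum :: "(nat \<Rightarrow> int) \<Rightarrow> nat \<Rightarrow> nat \<Rightarrow> int" where
  "degree_sum p r s = (\<Sum>l\<in>{r<..s}. p l)"

text \<open>
  The degree that the equation for \<open>d (a r s)\<close> imposes on the entry \<open>a r s\<close> of a defining system:
  each of the \<open>s - r - 1\<close> steps that build it from the \<open>x l\<close> lowers the degree by one.
\<close>

definition entry_degree :: "(nat \<Rightarrow> int) \<Rightarrow> nat \<Rightarrow> nat \<Rightarrow> int" where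
  "entry_degree p r s = degree_sum p r s - int (s - r) + 1"

definition sign_exponent :: "(nat \<Rightarrow> int) \<Rightarrow> nat \<Rightarrow> nat \<Rightarrow> int" where
  "sign_exponent p r s = 1 + (\<Sum>l\<in>{r<..s}. int (s - l) * p l)"

lemma sum_split:
  fixes f :: "nat \<Rightarrow> int"
  assumes "r \<le> k" "k \<le> s"
  shows "(\<Sum>l\<in>{r<..s}. f l) = (\<Sum>l\<in>{r<..k}. f l) + (\<Sum>l\<in>{k<..s}. f l)"
proof -
  have "{r<..s} = {r<..k} \<union> {k<..s}" using assms by auto
  then show ?thesis by (simp add: sum.union_disjoint)
qed

lemma entry_degree_split:
  assumes "r \<le> k" "k \<le> s"
  shows "entry_degree p r k + entry_degree p k s = entry_degree p r s + 1"
  using sum_split[OF assms, of p] assms by (simp add: entry_degree_def degree_sum_def)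

text \<open>
  Cutting at \<open>k\<close> replaces the weight \<open>s - l\<close> of a letter of the left part by \<open>k - l\<close>. The
  difference \<open>s - k\<close> does not depend on the letter, so it multiplies the total degree of the left
  part, just as the Koszul sign does.
\<close>

lemma sign_exponent_split:
  assumes "r \<le> k" "k \<le> s"
  shows "sign_exponent p r s =
    sign_exponent p r k + sign_exponent p k s - 1 + int (s - k) * degree_sum p r k"
proof -
  have "(\<Sum>l\<in>{r<..k}. int (s - l) * p l) =
      (\<Sum>l\<in>{r<..k}. int (k - l) * p l + int (s - k) * p l)"
    using assms by (intro sum.cong) (auto simp: of_nat_diff algebra_simps)
  then show ?thesis
    using sum_split[OF assms, of "\<lambda>l. int (s - l) * p l"]
    by (simp add: sign_exponent_def degree_sum_def sum.distrib sum_distrib_left)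
qed

lemma sign_exponent_parity:
  "even (1 + (\<Sum>l | 1 \<le> l \<and> l \<le> n - 1 \<and> even (n - 1 - l). p l) - sign_exponent p 0 n)"
proof -
  have eq: "{l. 1 \<le> l \<and> l \<le> n - 1 \<and> even (n - 1 - l)} = {l \<in> {0<..n}. odd (n - l)}"
    by (auto simp: even_diff_nat) presburger+
  have "(\<Sum>l | 1 \<le> l \<and> l \<le> n - 1 \<and> even (n - 1 - l). p l) =
      (\<Sum>l\<in>{0<..n}. if odd (n - l) then p l else 0)"
    unfolding eq by (rule sum.inter_filter) simp
  then have "1 + (\<Sum>l | 1 \<le> l \<and> l \<le> n - 1 \<and> even (n - 1 - l). p l) - sign_exponent p 0 n =
      (\<Sum>l\<in>{0<..n}. (if odd (n - l) then p l else 0) - int (n - l) * p l)"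
    by (simp add: sign_exponent_def sum_subtractf)
  moreover have "even \<dots>"
    by (rule dvd_sum) (auto simp del: of_nat_diff)
  ultimately show ?thesis by simp
qed

text \<open>
  The sign of the cut at \<open>k\<close> in the recursion for \<open>\<lambda>\<close>, times the signs of the two factors, is the sign
  of the whole word times the sign of \<open>bar\<close> on the left factor.
\<close>

lemma sign_cut:
  assumes "r < k" "k < s"
  shows "(-1 :: 'k::field) ^ (k - r + 1) * (-1) powi ((1 - int (s - k)) * degree_sum p r k) *
      ((-1) powi sign_exponent p r k * (-1) powi sign_exponent p k s) =
    (-1) powi sign_exponent p r s * (-1) powi (entry_degree p r k + 1)"
proof -
  have "(-1 :: 'k) ^ (k - r + 1) = (-1) powi int (k - r + 1)"
    by (simp only: power_int_of_nat)
  moreover have "even (int (k - r + 1) + (1 - int (s - k)) * degree_sum p r k +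
      (sign_exponent p r k + sign_exponent p k s) -
      (sign_exponent p r s + (entry_degree p r k + 1)))"
    (is "even ?e")
  proof -
    have "?e = 2 * (int (k - r) - int (s - k) * degree_sum p r k)"
      using sign_exponent_split[of r k s p] assms
      by (simp add: entry_degree_def algebra_simps)
    then show ?thesis by simp
  qed
  ultimately show ?thesis
    by (simp only: minus_one_powi_add[symmetric] minus_one_powi_cong)
qed

section \<open>The grading and the twist on cohomology\<close>

context dga
begin

interpretation d: Vector_Spaces.linear scale scale d
  by (rule linear_d)

lemma component_eqI:
  assumes "finite S" "\<And>r. f r \<in> gr r" "\<And>r. r \<notin> S \<Longrightarrow> f r = 0" "a = sum f S"
  shows "component a = f"
proof -
  have "{r. f r \<noteq> 0} \<subseteq> S" using assms(3) by auto
  moreover from this have "sum f {r. f r \<noteq> 0} = sum f S"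
    using assms(1) by (intro sum.mono_neutral_left) auto
  ultimately have "(\<forall>r. f r \<in> gr r) \<and> finite {r. f r \<noteq> 0} \<and> a = (\<Sum>r | f r \<noteq> 0. f r)"
    using assms finite_subset by auto
  then show ?thesis
    unfolding component_def by (rule the1_equality[OF gr_decomposition])
qed

lemma component_decomposition:
  "component a r \<in> gr r" "finite {r. component a r \<noteq> 0}" "(\<Sum>r | component a r \<noteq> 0. component a r) = a"
  using theI'[OF gr_decomposition, of a] unfolding component_def by auto

lemma sum_component:
  assumes "finite S" "{r. component a r \<noteq> 0} \<subseteq> S"
  shows "(\<Sum>r\<in>S. component a r) = a"
proof -
  have "(\<Sum>r\<in>S. component a r) = (\<Sum>r | component a r \<noteq> 0. component a r)"
    using assms by (intro sum.mono_neutral_right) auto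
  then show ?thesis by (simp add: component_decomposition)
qed

lemma twist_sum_component:
  assumes "finite S" "{r. component a r \<noteq> 0} \<subseteq> S"
  shows "twist e a = (\<Sum>r\<in>S. (-1) powi (e * r) *s component a r)"
  unfolding twist_def using assms by (intro sum.mono_neutral_left) auto

lemma component_add: "component (a + b) r = component a r + component b r"
proof -
  let ?S = "{r. component a r \<noteq> 0} \<union> {r. component b r \<noteq> 0}"
  have "component (a + b) = (\<lambda>r. component a r + component b r)"
    by (rule component_eqI[of ?S])
      (auto simp: component_decomposition sum.distrib sum_component intro: subspace_add subspace_gr)
  then show ?thesis by simp
qed

lemma twist_add: "twist e (a + b) = twist e a + twist e b"
proof -
  let ?S = "{r. component a r \<noteq> 0} \<union> {r. component b r \<noteq> 0}"
  have "finite ?S" by (simp add: component_decomposition)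
  moreover have "{r. component (a + b) r \<noteq> 0} \<subseteq> ?S" by (auto simp: component_add)
  ultimately show ?thesis
    by (simp add: twist_sum_component[of ?S] component_add scale_right_distrib sum.distrib)
qed

lemma component_twist: "component (twist e a) r = (-1) powi (e * r) *s component a r"
proof -
  have "component (twist e a) = (\<lambda>r. (-1) powi (e * r) *s component a r)"
    by (rule component_eqI[of "{r. component a r \<noteq> 0}"])
      (auto simp: component_decomposition twist_def intro: subspace_scale subspace_gr)
  then show ?thesis by simp
qed

lemma twist_twist: "twist e (twist e a) = a"
proof -
  let ?S = "{r. component a r \<noteq> 0}"
  have "twist e (twist e a) = (\<Sum>r\<in>?S. (-1) powi (e * r) *s component (twist e a) r)"
    by (rule twist_sum_component) (auto simp: component_decomposition component_twist)
  also have "\<dots> = (\<Sum>r\<in>?S. component a r)"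
    by (rule sum.cong) (auto simp: component_twist minus_one_powi)
  finally show ?thesis by (simp add: component_decomposition)
qed

lemma component_d: "component (d a) r = d (component a (r - 1))"
proof -
  let ?S = "{r. component a r \<noteq> 0}"
  have "d a = d (\<Sum>r\<in>?S. component a r)"
    by (simp add: component_decomposition)
  also have "\<dots> = (\<Sum>r\<in>?S. d (component a r))"
    by (rule d.sum)
  also have "\<dots> = (\<Sum>r\<in>(\<lambda>r. r + 1) ` ?S. d (component a (r - 1)))"
    by (simp add: sum.reindex)
  finally have sum: "d a = \<dots>" .
  have "d (component a (r - 1)) \<in> gr r" for r
    using d_gr[of "component a (r - 1)" "r - 1"] by (simp add: component_decomposition)
  moreover have "d (component a (r - 1)) = 0" if "r \<notin> (\<lambda>r. r + 1) ` ?S" for r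
  proof -
    have "component a (r - 1) = 0"
    proof (rule ccontr)
      assume "component a (r - 1) \<noteq> 0"
      then have "r \<in> (\<lambda>r. r + 1) ` ?S" by (intro image_eqI[of _ _ "r - 1"]) auto
      with that show False by simp
    qed
    then show ?thesis by (simp add: d.zero)
  qed
  ultimately have "component (d a) = (\<lambda>r. d (component a (r - 1)))"
    by (intro component_eqI[OF _ _ _ sum]) (auto simp: component_decomposition)
  then show ?thesis by simp
qed

text \<open>
  Up to the sign of \<open>e\<close>, the twist commutes with \<open>d\<close>; as it is also an involution, it maps \<open>range d\<close>
  onto itself, which makes it act on cosets of \<open>range d\<close>.
\<close>

lemma twist_d_in_range: "twist e (d a) \<in> range d"
proof -
  have "twist e (d a) = (\<Sum>r | component (d a) r \<noteq> 0. d ((-1) powi (e * r) *s component a (r - 1)))"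
    by (simp add: twist_def component_d d.scale)
  also have "\<dots> = d (\<Sum>r | component (d a) r \<noteq> 0. (-1) powi (e * r) *s component a (r - 1))"
    by (simp only: d.sum)
  finally show ?thesis by blast
qed

lemma twist_range_d: "twist e ` range d = range d"
proof
  show "twist e ` range d \<subseteq> range d" using twist_d_in_range by auto
  show "range d \<subseteq> twist e ` range d"
  proof
    fix b assume "b \<in> range d"
    then have "twist e b \<in> range d" using twist_d_in_range by auto
    then show "b \<in> twist e ` range d" by (metis twist_twist image_eqI)
  qed
qed

lemma self_in_cls: "a \<in> cls a"
proof -
  have "a + d 0 \<in> cls a" unfolding cls_def by (rule set_plus_intro2) (rule rangeI)
  then show ?thesis by (simp add: d.zero)
qed

lemma cls_eq_iff: "cls a = cls b \<longleftrightarrow> a - b \<in> range d"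
proof
  assume "cls a = cls b"
  then have "a \<in> cls b" using self_in_cls[of a] by simp
  then show "a - b \<in> range d" by (auto simp: cls_def elt_set_plus_def)
next
  assume "a - b \<in> range d"
  then obtain c where c: "a = b + d c" by (metis rangeE diff_add_cancel add.commute)
  have "b + d c + d w \<in> cls b" for w
    unfolding cls_def elt_set_plus_def by (auto simp: add.assoc d.add[symmetric])
  moreover have "b + d w \<in> cls (b + d c)" for w
  proof -
    have "b + d w = (b + d c) + d (w - c)" by (simp add: d.diff)
    then show ?thesis unfolding cls_def elt_set_plus_def by blast
  qed
  ultimately show "cls a = cls b"
    unfolding c by (auto simp: cls_def elt_set_plus_def)
qed

lemma hscale_cls: "hscale c (cls z) = cls (c *s z)"
proof
  show "hscale c (cls z) \<subseteq> cls (c *s z)"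
  proof
    fix b assume "b \<in> hscale c (cls z)"
    then obtain u v where "b = c *s (z + d u) + d v"
      by (auto simp: hscale_def cls_def elt_set_plus_def elim!: set_plus_elim)
    then have "b = c *s z + d (c *s u + v)"
      by (simp add: scale_right_distrib d.add d.scale add.assoc)
    then show "b \<in> cls (c *s z)" by (auto simp: cls_def elt_set_plus_def)
  qed
  have "c *s z \<in> scale c ` cls z" using self_in_cls by blast
  then show "cls (c *s z) \<subseteq> hscale c (cls z)"
    unfolding hscale_def by (auto simp: cls_def[of "c *s z"] elt_set_plus_def intro: set_plus_intro)
qed

lemma hscale_hscale: "X \<in> cohomology \<Longrightarrow> hscale c (hscale c' X) = hscale (c * c') X"
  by (auto simp: cohomology_def hscale_cls)

lemma hscale_hgr: "X \<in> hgr r \<Longrightarrow> hscale c X \<in> hgr r"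
  using subspace_scale[OF subspace_gr] by (auto simp: hgr_def hscale_cls cocycles_def d.scale)

lemma hgr_cohomology: "X \<in> hgr r \<Longrightarrow> X \<in> cohomology"
  by (auto simp: hgr_def cohomology_def)

lemma htwist_hgr:
  assumes "X \<in> hgr r"
  shows "htwist e X = hscale ((-1) powi (e * r)) X"
proof -
  obtain z where z: "z \<in> gr r" "X = cls z" using assms by (auto simp: hgr_def)
  have "htwist e X = (\<lambda>b. twist e (z + b)) ` range d"
    by (auto simp: htwist_def z cls_def elt_set_plus_def)
  also have "\<dots> = (\<lambda>b. twist e z + b) ` (twist e ` range d)"
    by (simp add: twist_add image_image)
  also have "\<dots> = (\<lambda>b. twist e z + b) ` range d"
    by (simp only: twist_range_d)
  also have "\<dots> = cls ((-1) powi (e * r) *s z)"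
    by (auto simp: cls_def elt_set_plus_def twist_homogeneous[OF z(1)])
  finally show ?thesis by (simp add: z hscale_cls)
qed

lemma htwist_htwist:
  assumes "X \<in> hgr r"
  shows "htwist e (htwist e' X) = htwist (e + e') X"
  by (simp only: htwist_hgr[OF assms] htwist_hgr[OF hscale_hgr[OF assms]]
      hscale_hscale[OF hgr_cohomology[OF assms]] minus_one_powi_add distrib_right)

lemma degree_unique:
  assumes "a \<in> gr r" "a \<in> gr s" "a \<noteq> 0"
  shows "r = s"
proof -
  have "component a = (\<lambda>t. if t = u then a else 0)" if "a \<in> gr u" for u
    by (rule component_eqI[of "{u}"]) (use that subspace_0[OF subspace_gr] in auto)
  from this[OF assms(1)] this[OF assms(2)] assms(3) show ?thesis
    by (metis (full_types))
qed

text \<open>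
  The zero element has every degree, so \<open>degree 0\<close> is arbitrary; the equation holds there because
  both sides vanish.
\<close>

lemma bar_homogeneous:
  assumes "a \<in> gr r"
  shows "bar a = (-1) powi (r + 1) *s a"
proof (cases "a = 0")
  case False
  have "a \<in> gr (degree a)" unfolding degree_def by (rule someI[of _ r]) (rule assms)
  then show ?thesis using degree_unique[OF assms _ False] by (simp add: bar_def)
qed (simp add: bar_def)

section \<open>The cocycle of a defining system\<close>

lemma gr_bar_mult:
  assumes "a \<in> gr r" "b \<in> gr s"
  shows "bar a * b \<in> gr (r + s)"
  using mult_gr[OF assms] subspace_scale[OF subspace_gr]
  by (simp add: bar_homogeneous[OF assms(1)] scale_mult_left)

text \<open>
  Expanding \<open>d\<close> gives each triple product \<open>a 0 l * bar (a l k) * a k n\<close> with \<open>l < k\<close> twice: once from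
  \<open>d (a 0 k)\<close> and once, with the opposite sign, from \<open>d (a l n)\<close>.
\<close>

lemma cocycle_massey:
  assumes deg: "\<And>r s. r < s \<Longrightarrow> s \<le> n \<Longrightarrow> s - r \<le> n - 1 \<Longrightarrow> a r s \<in> gr (entry_degree p r s)"
    and d_a: "\<And>r s. r < s \<Longrightarrow> s \<le> n \<Longrightarrow> s - r \<le> n - 1 \<Longrightarrow>
      d (a r s) = (\<Sum>k\<in>{r<..<s}. bar (a r k) * a k s)"
  shows "d (\<Sum>k\<in>{0<..<n}. bar (a 0 k) * a k n) = 0"
proof -
  define T where "T l k = a 0 l * (bar (a l k) * a k n)" for l k
  have summand: "d (bar (a 0 k) * a k n) = (\<Sum>l\<in>{0<..<k}. T l k) - (\<Sum>m\<in>{k<..<n}. T k m)"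
    if k: "k \<in> {0<..<n}" for k
  proof -
    let ?D = "entry_degree p 0 k"
    have deg_k: "a 0 k \<in> gr ?D" using k by (intro deg) auto
    have "d (bar (a 0 k) * a k n) =
        (-1) powi (?D + 1) *s (d (a 0 k) * a k n + (-1) powi ?D *s (a 0 k * d (a k n)))"
      by (simp only: bar_homogeneous[OF deg_k] scale_mult_left d.scale leibniz[OF deg_k])
    also have "\<dots> = (-1) powi (?D + 1) *s (d (a 0 k) * a k n) - a 0 k * d (a k n)"
      by (simp add: scale_right_distrib minus_one_powi)
    also have "(-1) powi (?D + 1) *s (d (a 0 k) * a k n) =
        (\<Sum>l\<in>{0<..<k}. (-1) powi (?D + 1) *s (bar (a 0 l) * a l k * a k n))"
      using k by (subst d_a) (auto simp: sum_distrib_right scale_sum_right)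
    also have "\<dots> = (\<Sum>l\<in>{0<..<k}. T l k)"
    proof (rule sum.cong)
      fix l assume l: "l \<in> {0<..<k}"
      have deg_l: "a 0 l \<in> gr (entry_degree p 0 l)" "a l k \<in> gr (entry_degree p l k)"
        using k l by (auto intro!: deg)
      have "even (?D + 1 + (entry_degree p 0 l + 1) - (entry_degree p l k + 1))"
        using entry_degree_split[of 0 l k p] l
        by (simp add: algebra_simps)
      then have "(-1 :: 'k) powi (?D + 1) * (-1) powi (entry_degree p 0 l + 1) =
          (-1) powi (entry_degree p l k + 1)"
        unfolding minus_one_powi_add[symmetric] by (rule minus_one_powi_cong)
      then show "(-1) powi (?D + 1) *s (bar (a 0 l) * a l k * a k n) = T l k"
        by (simp only: T_def bar_homogeneous[OF deg_l(1)] bar_homogeneous[OF deg_l(2)]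
            scale_mult_left scale_mult_right scale_scale mult.assoc)
    qed simp
    also have "a 0 k * d (a k n) = (\<Sum>m\<in>{k<..<n}. T k m)"
      using k by (subst d_a) (auto simp: sum_distrib_left T_def)
    finally show ?thesis .
  qed
  have "(\<Sum>k\<in>{0<..<n}. \<Sum>l\<in>{0<..<k}. T l k) = (\<Sum>l\<in>{0<..<n}. \<Sum>k\<in>{l<..<n}. T l k)"
    unfolding sum.Sigma[OF finite_greaterThanLessThan ballI[OF finite_greaterThanLessThan]]
    by (rule sum.reindex_bij_witness[of _ prod.swap prod.swap]) auto
  then have "(\<Sum>k\<in>{0<..<n}. d (bar (a 0 k) * a k n)) = 0"
    by (simp add: summand sum_subtractf)
  then show ?thesis by (simp add: d.sum)
qed

end

section \<open>The induced operations on homogeneous classes\<close>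

context contraction
begin

interpretation d: Vector_Spaces.linear scale scale d
  by (rule linear_d)

interpretation K: Vector_Spaces.linear scale scale K
  by (rule linear_K)

lemma lam_word_cut:
  "lam (word x r s) = (\<Sum>k\<in>{r<..<s}. (-1) ^ (k - r + 1) *s
    (Klam (word (htwist (1 - int (s - k)) \<circ> x) r k) * Klam (word x k s)))"
proof -
  have "lam (word x r s) = (\<Sum>t\<in>{1..<s - r}. (-1) ^ (t + 1) *s
      (Klam (map (htwist (1 - int (s - r - t))) (take t (word x r s))) *
       Klam (drop t (word x r s))))"
    by (subst lam.simps) simp
  also have "\<dots> = (\<Sum>k\<in>{r<..<s}. (-1) ^ (k - r + 1) *s
      (Klam (map (htwist (1 - int (s - r - (k - r)))) (take (k - r) (word x r s))) *
       Klam (drop (k - r) (word x r s))))"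
    by (rule sum.reindex_bij_witness[of _ "\<lambda>k. k - r" "\<lambda>t. t + r"]) auto
  also have "\<dots> = (\<Sum>k\<in>{r<..<s}. (-1) ^ (k - r + 1) *s
      (Klam (word (htwist (1 - int (s - k)) \<circ> x) r k) * Klam (word x k s)))"
    by (rule sum.cong) (auto simp: take_word drop_word map_word)
  finally show ?thesis .
qed

lemma Klam_word_single: "Klam (word x r (Suc r)) = - i (x (Suc r))"
  by (subst Klam.simps) (simp add: word_def)

lemma Klam_word: "s \<noteq> Suc r \<Longrightarrow> Klam (word x r s) = K (lam (word x r s))"
  by (subst Klam.simps) auto

text \<open>
  On homogeneous classes a twist is a scalar, and \<open>Klam\<close> is multilinear, so twisting all arguments
  by \<open>e\<close> multiplies the value by the sign of \<open>e\<close> times their total degree. The induction is over all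
  \<open>e\<close> at once, since a twist inside the recursion composes with the given one to a twist again.
\<close>

lemma Klam_twist:
  assumes "\<And>l. l \<in> {r<..s} \<Longrightarrow> x l \<in> hgr (p l)"
  shows "Klam (word (htwist e \<circ> x) r s) = (-1) powi (e * degree_sum p r s) *s Klam (word x r s)"
  using assms
proof (induction "s - r" arbitrary: r s e x rule: less_induct)
  case less
  show ?case
  proof (cases "s = Suc r")
    case True
    have X: "x s \<in> hgr (p s)" using less.prems True by auto
    have "{r<..s} = {s}" using True by auto
    then have "degree_sum p r s = p s" by (simp add: degree_sum_def)
    then show ?thesis
      using X by (simp add: True Klam_word_single htwist_hgr i_scale hgr_cohomology)
  next
    case False
    have "lam (word (htwist e \<circ> x) r s) = (\<Sum>k\<in>{r<..<s}. (-1) ^ (k - r + 1) *s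
        (Klam (word (htwist (1 - int (s - k)) \<circ> (htwist e \<circ> x)) r k) *
         Klam (word (htwist e \<circ> x) k s)))"
      by (rule lam_word_cut)
    also have "\<dots> = (\<Sum>k\<in>{r<..<s}. (-1) powi (e * degree_sum p r s) *s ((-1) ^ (k - r + 1) *s
        (Klam (word (htwist (1 - int (s - k)) \<circ> x) r k) * Klam (word x k s))))"
    proof (rule sum.cong)
      fix k assume k: "k \<in> {r<..<s}"
      let ?f = "1 - int (s - k)"
      have "word (htwist ?f \<circ> (htwist e \<circ> x)) r k = word (htwist (?f + e) \<circ> x) r k"
        unfolding comp_def
        by (rule word_cong, rule htwist_htwist, rule less.prems) (use k in auto)
      moreover have "Klam (word (htwist f \<circ> x) r k) =
          (-1) powi (f * degree_sum p r k) *s Klam (word x r k)" for f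
        by (rule less.hyps) (use k less.prems in auto)
      moreover have "Klam (word (htwist e \<circ> x) k s) =
          (-1) powi (e * degree_sum p k s) *s Klam (word x k s)"
        by (rule less.hyps) (use k less.prems in auto)
      moreover have "degree_sum p r s = degree_sum p r k + degree_sum p k s"
        unfolding degree_sum_def using k by (intro sum_split) auto
      ultimately show "(-1) ^ (k - r + 1) *s
          (Klam (word (htwist ?f \<circ> (htwist e \<circ> x)) r k) * Klam (word (htwist e \<circ> x) k s)) =
          (-1) powi (e * degree_sum p r s) *s ((-1) ^ (k - r + 1) *s
            (Klam (word (htwist ?f \<circ> x) r k) * Klam (word x k s)))"
        by (simp only: scale_mult_left scale_mult_right scale_scale minus_one_powi_add
            distrib_left distrib_right mult_ac)
    qed simp
    finally have "lam (word (htwist e \<circ> x) r s) =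
        (-1) powi (e * degree_sum p r s) *s lam (word x r s)"
      by (simp only: lam_word_cut scale_sum_right)
    then show ?thesis using False by (simp add: Klam_word K.scale)
  qed
qed

text \<open>
  Applying \<open>K\<close> to the homotopy identity at \<open>d c\<close> gives \<open>K (d (K (d c))) = K (d c)\<close>, because
  \<open>K \<circ> i\<close> and \<open>d \<circ> d\<close> vanish.
\<close>

lemma K_d_eq:
  assumes "b \<in> K ` range d"
  shows "K (d b) = b"
proof -
  obtain c where b: "b = K (d c)" using assms by auto
  have "d c = i (q (d c)) + d (K (d c))"
    using homotopy[of "d c"] by (simp add: d_d K.zero algebra_simps)
  then have "K (d c) = K (i (q (d c))) + K (d (K (d c)))"
    by (metis K.add)
  then show ?thesis by (simp add: b K_i q_cohomology)
qed

lemma q_cocycle: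
  assumes "d z = 0"
  shows "q z = cls z"
proof -
  have "z - i (q z) \<in> range d" using homotopy[of z] by (simp add: assms K.zero)
  then have "cls z = cls (i (q z))" by (simp add: cls_eq_iff)
  then show ?thesis by (simp add: i_represents q_cohomology)
qed

end

section \<open>Contractions adapted to a defining system\<close>

locale adapted_system = contraction +
  fixes n :: nat and x :: "nat \<Rightarrow> 'b set" and p :: "nat \<Rightarrow> int" and a :: "nat \<Rightarrow> nat \<Rightarrow> 'b"
  assumes x_hgr: "l \<in> {1..n} \<Longrightarrow> x l \<in> hgr (p l)"
    and system: "defining_system n x a"
    and i_x: "l \<in> {1..n} \<Longrightarrow> i (x l) = a (l - 1) l"
    and entry_in_K: "r < s \<Longrightarrow> s \<le> n \<Longrightarrow> 2 \<le> s - r \<Longrightarrow> s - r \<le> n - 1 \<Longrightarrow> a r s \<in> K ` range d"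
begin

interpretation d: Vector_Spaces.linear scale scale d
  by (rule linear_d)

interpretation K: Vector_Spaces.linear scale scale K
  by (rule linear_K)

text \<open>For neighbouring indices the sum is empty, and the entry is a cocycle.\<close>

lemma d_entry:
  assumes "r < s" "s \<le> n" "s - r \<le> n - 1"
  shows "d (a r s) = (\<Sum>k\<in>{r<..<s}. bar (a r k) * a k s)"
proof (cases "2 \<le> s - r")
  case True
  then show ?thesis using system assms unfolding defining_system_def by blast
next
  case False
  then have s: "s = Suc r" using assms by simp
  then have "s \<in> {1..n}" using assms by simp
  then have "a (s - 1) s \<in> cocycles"
    using system unfolding defining_system_def by blast
  then have "d (a r s) = 0" by (simp add: s cocycles_def)
  moreover have "{r<..<s} = {}" using s by auto
  ultimately show ?thesis by simp
qed

text \<open>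
  A defining system only asks for some degree. Here the degree is determined because \<open>a r s\<close> is \<open>K\<close>
  of the sum that equals \<open>d (a r s)\<close>.
\<close>

lemma entry_gr:
  "r < s \<Longrightarrow> s \<le> n \<Longrightarrow> s - r \<le> n - 1 \<Longrightarrow> a r s \<in> gr (entry_degree p r s)"
proof (induction "s - r" arbitrary: r s rule: less_induct)
  case less
  show ?case
  proof (cases "2 \<le> s - r")
    case True
    have "bar (a r k) * a k s \<in> gr (entry_degree p r s + 1)" if k: "k \<in> {r<..<s}" for k
    proof -
      have "bar (a r k) * a k s \<in> gr (entry_degree p r k + entry_degree p k s)"
        by (intro gr_bar_mult less.hyps) (use k less.prems in auto)
      then show ?thesis using entry_degree_split[of r k s p] k by simp
    qed
    then have "d (a r s) \<in> gr (entry_degree p r s + 1)"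
      unfolding d_entry[OF less.prems] by (intro subspace_sum subspace_gr)
    from K_gr[OF this] show ?thesis
      using K_d_eq[OF entry_in_K] less.prems True by simp
  next
    case False
    then have s: "s = Suc r" using less.prems by simp
    have "{r<..s} = {s}" using s by auto
    then have "entry_degree p r s = p s" using s by (simp add: entry_degree_def degree_sum_def)
    moreover have "i (x s) \<in> gr (p s)" using less.prems s by (intro i_gr x_hgr) auto
    ultimately show ?thesis using i_x[of s] less.prems s by simp
  qed
qed

text \<open>
  The equation for \<open>lam\<close> from the one for \<open>Klam\<close> on strictly shorter subwords. It serves both as the
  step of the induction for \<open>Klam\<close> and, once that is complete, for the full word, to which no entry
  of the defining system corresponds.
\<close>

lemma lam_word_step:
  assumes "s \<le> n"
    and Klam: "\<And>u v. r \<le> u \<Longrightarrow> u < v \<Longrightarrow> v \<le> s \<Longrightarrow> v - u < s - r \<Longrightarrow>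
      Klam (word x u v) = (-1) powi sign_exponent p u v *s a u v"
  shows "lam (word x r s) =
    (-1) powi sign_exponent p r s *s (\<Sum>k\<in>{r<..<s}. bar (a r k) * a k s)"
proof -
  have "lam (word x r s) = (\<Sum>k\<in>{r<..<s}. (-1) powi sign_exponent p r s *s (bar (a r k) * a k s))"
    unfolding lam_word_cut
  proof (rule sum.cong)
    fix k assume k: "k \<in> {r<..<s}"
    let ?f = "1 - int (s - k)"
    have "a r k \<in> gr (entry_degree p r k)" using k assms(1) by (intro entry_gr) auto
    note bar = bar_homogeneous[OF this]
    have "Klam (word (htwist ?f \<circ> x) r k) =
        (-1) powi (?f * degree_sum p r k) *s Klam (word x r k)"
      by (rule Klam_twist) (use k assms(1) in \<open>auto intro!: x_hgr\<close>)
    moreover have "Klam (word x r k) = (-1) powi sign_exponent p r k *s a r k"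
      and "Klam (word x k s) = (-1) powi sign_exponent p k s *s a k s"
      using k by (auto intro!: Klam)
    ultimately have "(-1) ^ (k - r + 1) *s
        (Klam (word (htwist ?f \<circ> x) r k) * Klam (word x k s)) =
        ((-1) ^ (k - r + 1) * (-1) powi (?f * degree_sum p r k) *
          ((-1) powi sign_exponent p r k * (-1) powi sign_exponent p k s)) *s (a r k * a k s)"
      by (simp only: scale_mult_left scale_mult_right scale_scale mult_ac)
    also have "\<dots> = (-1) powi sign_exponent p r s *s (bar (a r k) * a k s)"
      using k by (subst sign_cut) (auto simp only: bar scale_mult_left scale_scale greaterThanLessThan_iff)
    finally show "(-1) ^ (k - r + 1) *s
        (Klam (word (htwist ?f \<circ> x) r k) * Klam (word x k s)) =
        (-1) powi sign_exponent p r s *s (bar (a r k) * a k s)" .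
  qed simp
  then show ?thesis by (simp only: scale_sum_right)
qed

text \<open>
  A word of one letter has sign exponent 1, which is the convention that \<open>K \<lambda>\<close> is \<open>- i\<close> there.
\<close>

lemma Klam_word_entry:
  "r < s \<Longrightarrow> s \<le> n \<Longrightarrow> s - r \<le> n - 1 \<Longrightarrow>
    Klam (word x r s) = (-1) powi sign_exponent p r s *s a r s"
proof (induction "s - r" arbitrary: r s rule: less_induct)
  case less
  show ?case
  proof (cases "2 \<le> s - r")
    case True
    have "lam (word x r s) =
        (-1) powi sign_exponent p r s *s (\<Sum>k\<in>{r<..<s}. bar (a r k) * a k s)"
      by (rule lam_word_step) (use less in auto)
    also have "\<dots> = (-1) powi sign_exponent p r s *s d (a r s)"
      using less.prems by (simp add: d_entry)
    finally have "K (lam (word x r s)) = (-1) powi sign_exponent p r s *s K (d (a r s))"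
      by (simp add: K.scale)
    then show ?thesis
      using K_d_eq[OF entry_in_K] less.prems True by (simp add: Klam_word)
  next
    case False
    then have s: "s = Suc r" using less.prems by simp
    have "{r<..s} = {s}" using s by auto
    then have "sign_exponent p r s = 1" by (simp add: sign_exponent_def)
    then show ?thesis
      using i_x[of s] less.prems by (simp add: s Klam_word_single)
  qed
qed

text \<open>The sign is its own inverse, so it may be moved to the side of \<open>mu\<close>.\<close>

lemma hscale_mu_word:
  "hscale ((-1) powi sign_exponent p 0 n) (mu (word x 0 n)) = given_class n a"
proof -
  let ?z = "\<Sum>k\<in>{0<..<n}. bar (a 0 k) * a k n" and ?e = "(-1 :: 'a) powi sign_exponent p 0 n"
  have "lam (word x 0 n) = ?e *s ?z"
    by (rule lam_word_step) (auto intro!: Klam_word_entry)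
  moreover have "?e * ?e = 1" by (simp add: minus_one_powi)
  ultimately have "hscale ?e (mu (word x 0 n)) = q ?z"
    by (simp add: mu_def q_scale[symmetric])
  also have "q ?z = cls ?z"
    by (intro q_cocycle cocycle_massey[where a = a and p = p] entry_gr d_entry)
  finally show ?thesis by (simp add: given_class_def)
qed

end

theorem theorem2:
  fixes scale :: "'k::field \<Rightarrow> 'a::ring \<Rightarrow> 'a"
    and gr :: "int \<Rightarrow> 'a set"
    and d :: "'a \<Rightarrow> 'a"
    and n :: nat
    and x :: "nat \<Rightarrow> 'a set"
    and p :: "nat \<Rightarrow> int"
    and y :: "'a set"
    and i :: "'a set \<Rightarrow> 'a"
    and q :: "'a \<Rightarrow> 'a set"
    and K :: "'a \<Rightarrow> 'a"
  assumes "dga scale gr d"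
    and "3 \<le> n"
    and "\<forall>j\<in>{1..n}. x j \<in> dga.hgr gr d (p j)"
    and "y \<in> dga.massey scale gr d n x"
    and "contraction scale gr d i q K"
    and "contraction.adapted scale gr d i K n x y"
  shows "dga.hscale scale d
      ((-1) powi (1 + (\<Sum>j | 1 \<le> j \<and> j \<le> n - 1 \<and> even (n - 1 - j). p j)))
      (contraction.mu scale gr i q K (map x [1..<n + 1])) = y"
proof -
  interpret contraction scale gr d i q K by fact
  from \<open>adapted n x y\<close> obtain a where a: "defining_system n x a" "given_class n a = y"
    "\<forall>j\<in>{1..n}. i (x j) = a (j - 1) j"
    "\<forall>r s. r < s \<and> s \<le> n \<and> 2 \<le> s - r \<and> s - r \<le> n - 1 \<longrightarrow> a r s \<in> K ` range d"
    unfolding adapted_def by blast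
  interpret adapted_system scale gr d i q K n x p a
    by unfold_locales (use assms(3) a in auto)
  have "map x [1..<n + 1] = word x 0 n" by (simp add: word_def)
  moreover have "(-1 :: 'k) powi (1 + (\<Sum>j | 1 \<le> j \<and> j \<le> n - 1 \<and> even (n - 1 - j). p j)) =
      (-1) powi sign_exponent p 0 n"
    by (rule minus_one_powi_cong[OF sign_exponent_parity])
  ultimately show ?thesis
    using hscale_mu_word a(2) by simp
qed

end
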